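(* Let $\theta^{(m)}_k$ ($k\in\mathbb{Z}$; $m=0,\dots,M+1$) be a solution of the discrete sine-Gordon equation $$\frac{1}{\Delta s}\left(\frac{\theta^{(m+1)}_{k+1}-\theta^{(m)}_{k+1}}{\Delta\tau}-\frac{\theta^{(m+1)}_{k}-\theta^{(m)}_{k}}{\Delta\tau}\right)=\frac{a^{(m)}_{k+1}+a^{(m)}_k}{2}\qquad(k\in\mathbb{Z};\ m=0,\dots,M)$$ under the boundary condition $$\theta^{(m)}_{k+K}=\theta^{(m)}_k+2n\pi\qquad(k\in\mathbb{Z};\ m=0,1,\dots,M+1)$$ for some $n\in\mathbb{Z}$. If $(x^{(m)}_k,u^{(m)}_k)$ is the curve obtained from $\theta^{(m)}_k$ via the discrete hodograph transformation $$x^{(m)}_k=x^{(m)}_0+\sum_{i=1}^k\cos\theta^{(m)}_i\,\Delta s,\qquad u^{(m)}_k=u^{(m)}_0+\sum_{i=1}^k\frac{a^{(m)}_i+a^{(m)}_{i-1}}{2}\,\Delta s$$ with some $(x^{(m)}_0,u^{(m)}_0)$, then $(x^{(m)}_k,u^{(m)}_k)$ satisfies the boundary condition $$x^{(m)}_{k+K}=x^{(m)}_k+L,\qquad u^{(m)}_{k+K}=u^{(m)}_k\qquad(k\in\mathbb{Z};\ m=0,\dots,M),$$ where the constant $L$ is determined by the initial condition: $L:=-\mathcal{H}_{\mathrm{d}}(\theta^{(0)})$.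
   Context: $K\ge1$ and $M\ge0$ are integers, $\Delta s,\Delta\tau>0$ are mesh sizes, all $\theta^{(m)}_k$ are real, and $\theta^{(m)}=(\theta^{(m)}_1,\dots,\theta^{(m)}_K)^\top$. The discrete functional is $\mathcal{H}_{\mathrm{d}}(\theta^{(m)})=-\sum_{k=1}^K\cos\theta^{(m)}_k\,\Delta s$. The numbers $$a^{(m)}_k:=\frac{\delta\mathcal{H}_{\mathrm{d}}}{\delta(\theta^{(m+1)},\theta^{(m)})_k}=-\frac{\cos\theta^{(m+1)}_k-\cos\theta^{(m)}_k}{\theta^{(m+1)}_k-\theta^{(m)}_k}$$ are the discrete variational derivative (understood as its limit $\sin\theta^{(m)}_k$ if $\theta^{(m+1)}_k=\theta^{(m)}_k$), defined for all $k\in\mathbb{Z}$ by the same formula. For $k\le0$ the discrete hodograph transformation is understood through its equivalent difference form, valid for all $k\in\mathbb{Z}$: $\frac{x^{(m)}_k-x^{(m)}_{k-1}}{\Delta s}=\cos\theta^{(m)}_k$ and $\frac{u^{(m)}_k-u^{(m)}_{k-1}}{\Delta s}=\frac{a^{(m)}_k+a^{(m)}_{k-1}}{2}$. *)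

theory Defs
  imports Complex_Main
begin

definition disc_hamiltonian :: "int \<Rightarrow> real \<Rightarrow> (int \<Rightarrow> real) \<Rightarrow> real" where
  "disc_hamiltonian K ds \<phi> = - (\<Sum>k=1..K. cos (\<phi> k) * ds)"

text \<open>Discrete variational derivative of \<^const>\<open>disc_hamiltonian\<close> at the pair
  \<open>(\<phi>, \<psi>)\<close> (new level, old level).  The first branch is the limit of the second
  one as \<open>\<phi> k\<close> tends to \<open>\<psi> k\<close>.\<close>

definition disc_var_deriv :: "(int \<Rightarrow> real) \<Rightarrow> (int \<Rightarrow> real) \<Rightarrow> int \<Rightarrow> real" where
  "disc_var_deriv \<phi> \<psi> k =
     (if \<phi> k = \<psi> k then sin (\<psi> k)
      else - ((cos (\<phi> k) - cos (\<psi> k)) / (\<phi> k - \<psi> k)))"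

definition disc_sine_gordon ::
  "nat \<Rightarrow> real \<Rightarrow> real \<Rightarrow> (nat \<Rightarrow> int \<Rightarrow> real) \<Rightarrow> bool" where
  "disc_sine_gordon M ds dt \<theta> \<longleftrightarrow>
     (\<forall>m\<le>M. \<forall>k.
        1 / ds * ((\<theta> (m + 1) (k + 1) - \<theta> m (k + 1)) / dt
                  - (\<theta> (m + 1) k - \<theta> m k) / dt)
        = (disc_var_deriv (\<theta> (m + 1)) (\<theta> m) (k + 1)
           + disc_var_deriv (\<theta> (m + 1)) (\<theta> m) k) / 2)"

text \<open>The hodograph transformation in difference form, so that it makes sense for all integers
  \<open>k\<close>.  The base points \<open>(x m 0, u m 0)\<close> are unconstrained.  The lemma below recovers
  the summation form for \<open>k \<ge> 0\<close>.\<close>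

definition disc_hodograph ::
  "nat \<Rightarrow> real \<Rightarrow> (nat \<Rightarrow> int \<Rightarrow> real) \<Rightarrow>
   (nat \<Rightarrow> int \<Rightarrow> real) \<Rightarrow> (nat \<Rightarrow> int \<Rightarrow> real) \<Rightarrow> bool" where
  "disc_hodograph M ds \<theta> x u \<longleftrightarrow>
     (\<forall>m\<le>M. \<forall>k.
        (x m k - x m (k - 1)) / ds = cos (\<theta> m k) \<and>
        (u m k - u m (k - 1)) / ds
          = (disc_var_deriv (\<theta> (m + 1)) (\<theta> m) k
             + disc_var_deriv (\<theta> (m + 1)) (\<theta> m) (k - 1)) / 2)"

lemma difference_form_iff_sum_form:
  fixes y f :: "int \<Rightarrow> real"
  assumes "ds > 0"
  shows "(\<forall>k\<ge>1. (y k - y (k - 1)) / ds = f k) \<longleftrightarrow>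
         (\<forall>k\<ge>0. y k = y 0 + (\<Sum>i=1..k. f i * ds))"
proof
  assume d: "\<forall>k\<ge>1. (y k - y (k - 1)) / ds = f k"
  have "y k = y 0 + (\<Sum>i=1..k. f i * ds)" if "k \<ge> 0" for k
    using that
  proof (induction k rule: int_ge_induct)
    case base
    then show ?case by simp
  next
    case (step k)
    have "{1..k + 1} = insert (k + 1) {1..k}" using step.hyps by auto
    moreover have "y (k + 1) = y k + f (k + 1) * ds"
      using d[rule_format, of "k + 1"] step.hyps assms by (simp add: field_simps)
    ultimately show ?case using step.IH by simp
  qed
  then show "\<forall>k\<ge>0. y k = y 0 + (\<Sum>i=1..k. f i * ds)" by blast
next
  assume s: "\<forall>k\<ge>0. y k = y 0 + (\<Sum>i=1..k. f i * ds)"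
  have "(y k - y (k - 1)) / ds = f k" if "k \<ge> 1" for k
  proof -
    have "{1..k} = insert k {1..k - 1}" using that by auto
    then have "y k - y (k - 1) = f k * ds"
      using s[rule_format, of k] s[rule_format, of "k - 1"] that by simp
    then show ?thesis using assms by simp
  qed
  then show "\<forall>k\<ge>1. (y k - y (k - 1)) / ds = f k" by blast
qed

lemma disc_hodograph_sum_form:
  assumes "disc_hodograph M ds \<theta> x u" and "ds > 0" and "m \<le> M" and "k \<ge> 0"
  shows "x m k = x m 0 + (\<Sum>i=1..k. cos (\<theta> m i) * ds)"
    and "u m k = u m 0 + (\<Sum>i=1..k.
           (disc_var_deriv (\<theta> (m + 1)) (\<theta> m) i
            + disc_var_deriv (\<theta> (m + 1)) (\<theta> m) (i - 1)) / 2 * ds)"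
  using assms difference_form_iff_sum_form[OF assms(2), of "x m" "\<lambda>i. cos (\<theta> m i)"]
    difference_form_iff_sum_form[OF assms(2), of "u m"
      "\<lambda>i. (disc_var_deriv (\<theta> (m + 1)) (\<theta> m) i
             + disc_var_deriv (\<theta> (m + 1)) (\<theta> m) (i - 1)) / 2"]
  unfolding disc_hodograph_def by blast+

end

theory Submission
  imports Defs
begin

text \<open>Write \<open>d k\<close> for the time increment \<open>\<theta> (m + 1) k - \<theta> m k\<close> and \<open>a k\<close> for the discrete
  variational derivative at level \<open>m\<close>.  Both are \<open>K\<close>-periodic, because the winding
  \<open>2 * n * pi\<close> is the same at the two time levels.

  For \<open>u\<close>: the discrete sine-Gordon equation and the hodograph transformation have the same
  right-hand side, so \<open>u m\<close> and \<open>d / dt\<close> have the same differences in \<open>k\<close>.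
  Hence \<open>u m - d / dt\<close> is constant in \<open>k\<close>, and \<open>u m\<close> inherits the period of \<open>d\<close>.

  For \<open>x\<close>: the cosines are \<open>K\<close>-periodic, so \<open>x m (k + K) - x m k\<close> does not depend on \<open>k\<close>, and
  at \<open>k = 0\<close> it equals \<open>- disc_hamiltonian K ds (\<theta> m)\<close>.  It remains to see that the discrete
  Hamiltonian is conserved in \<open>m\<close>.  By construction of the variational derivative
  (\<open>disc_var_deriv_chain_rule\<close>) its increment is the sum of \<open>a k * d k * ds\<close> over one
  period.  With \<open>c = ds * dt / 2\<close> the sine-Gordon equation reads
  \<open>d (k + 1) - c * a (k + 1) = d k + c * a k\<close>, so that
  \<open>4 * c * a k * d k = (d k + c * a k)\<^sup>2 - (d k - c * a k)\<^sup>2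
    = (d (k + 1) - c * a (k + 1))\<^sup>2 - (d k - c * a k)\<^sup>2\<close>,
  which telescopes to zero over a period (\<open>trapezoidal_orthogonality\<close>).  This is the discrete
  counterpart of the conservation of \<open>- \<integral> cos \<theta>\<close> along \<open>\<theta>\<^sub>\<tau>\<^sub>s = sin \<theta>\<close>:
  its derivative in \<open>\<tau>\<close> is the integral of \<open>sin \<theta> * \<theta>\<^sub>\<tau> = \<theta>\<^sub>\<tau>\<^sub>s * \<theta>\<^sub>\<tau>\<close>, the \<open>s\<close>-derivative
  of the periodic function \<open>\<theta>\<^sub>\<tau>\<^sup>2 / 2\<close>.\<close>

lemma constant_on_int_if_zero_difference:
  fixes f :: "int \<Rightarrow> 'a"
  assumes "\<And>k. f (k + 1) = f k"
  shows "f k = f 0"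
proof (induction k rule: int_induct[where k = 0])
  case base
  show ?case by simp
next
  case (step1 i)
  then show ?case using assms[of i] by simp
next
  case (step2 i)
  then show ?case using assms[of "i - 1"] by simp
qed

lemma sum_telescope_int:
  fixes f :: "int \<Rightarrow> 'a::ab_group_add"
  assumes "K \<ge> 0"
  shows "(\<Sum>k=1..K. f (k + 1) - f k) = f (K + 1) - f 1"
  using assms
proof (induction K rule: int_ge_induct)
  case base
  then show ?case by simp
next
  case (step i)
  have "{1..i + 1} = insert (i + 1) {1..i}" using step.hyps by auto
  then show ?case using step.IH by simp
qed

text \<open>On periodic sequences the operator taking \<open>d\<close> to the solution \<open>a\<close> of
  the trapezoidal equation below is formally the skew-adjoint Cayley transform
  \<open>(T - 1) / (T + 1)\<close> of the unitary shift \<open>T\<close>, up to the factor \<open>1 / c\<close>; hence \<open>a\<close> is orthogonal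
  to \<open>d\<close>.  For even \<open>K\<close> the operator \<open>T + 1\<close> has a kernel, so the proof does not invert it but
  uses a local identity that telescopes.\<close>

lemma trapezoidal_orthogonality:
  fixes a d :: "int \<Rightarrow> real"
  assumes "K \<ge> 0" and "c \<noteq> 0"
    and trapezoid: "\<And>k. d (k + 1) - d k = c * (a (k + 1) + a k)"
    and periodic: "\<And>k. a (k + K) = a k" "\<And>k. d (k + K) = d k"
  shows "(\<Sum>k=1..K. a k * d k) = 0"
proof -
  define q where "q k = (d k - c * a k)\<^sup>2" for k
  have local: "4 * c * (a k * d k) = q (k + 1) - q k" for k
  proof -
    have "d (k + 1) - c * a (k + 1) = d k + c * a k"
      using trapezoid[of k] by (simp add: algebra_simps)
    then show ?thesis
      by (simp add: q_def power2_eq_square algebra_simps)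
  qed
  have "4 * c * (\<Sum>k=1..K. a k * d k) = (\<Sum>k=1..K. q (k + 1) - q k)"
    by (simp add: sum_distrib_left local)
  also have "\<dots> = q (K + 1) - q 1"
    using assms(1) by (rule sum_telescope_int)
  also have "\<dots> = 0"
    using periodic[of 1] by (simp add: q_def add.commute)
  finally show ?thesis using assms(2) by simp
qed

lemma disc_var_deriv_chain_rule:
  "disc_var_deriv \<phi> \<psi> k * (\<phi> k - \<psi> k) = cos (\<psi> k) - cos (\<phi> k)"
  by (simp add: disc_var_deriv_def)

lemma cos_sin_add_int_multiple_2pi:
  "cos (y + 2 * of_int n * pi) = cos y" "sin (y + 2 * of_int n * pi) = sin y"
proof -
  have "2 * of_int n * pi = 2 * pi * of_int n" by simp
  then show "cos (y + 2 * of_int n * pi) = cos y" "sin (y + 2 * of_int n * pi) = sin y"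
    by (simp_all only: cos_add sin_add cos_int_2pin sin_int_2pin mult_1_right mult_zero_right diff_zero add_0_right)
qed

lemma disc_var_deriv_periodic:
  assumes "\<And>k. \<phi> (k + K) = \<phi> k + 2 * of_int n * pi"
    and "\<And>k. \<psi> (k + K) = \<psi> k + 2 * of_int n * pi"
  shows "disc_var_deriv \<phi> \<psi> (k + K) = disc_var_deriv \<phi> \<psi> k"
  by (simp add: disc_var_deriv_def assms cos_sin_add_int_multiple_2pi)

lemma disc_hamiltonian_conserved_step:
  assumes "K \<ge> 0" and "ds > 0" and "dt > 0" and "m \<le> M"
    and "disc_sine_gordon M ds dt \<theta>"
    and "\<forall>m\<le>M + 1. \<forall>k. \<theta> m (k + K) = \<theta> m k + 2 * of_int n * pi"
  shows "disc_hamiltonian K ds (\<theta> (m + 1)) = disc_hamiltonian K ds (\<theta> m)"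
proof -
  define a where "a = disc_var_deriv (\<theta> (m + 1)) (\<theta> m)"
  define d where "d k = \<theta> (m + 1) k - \<theta> m k" for k
  have eq: "1 / ds * (d (k + 1) / dt - d k / dt) = (a (k + 1) + a k) / 2" for k
    using assms(4,5) by (simp add: disc_sine_gordon_def a_def d_def)
  have "d (k + 1) - d k = ds * dt / 2 * (a (k + 1) + a k)" for k
    using eq[of k] assms(2,3) by (simp add: field_simps)
  moreover have "a (k + K) = a k" for k
    unfolding a_def by (rule disc_var_deriv_periodic[where n = n]) (use assms(4,6) in auto)
  moreover have "d (k + K) = d k" for k
    using assms(4,6) by (simp add: d_def)
  ultimately have "(\<Sum>k=1..K. a k * d k) = 0"
    using assms(1-3) by (intro trapezoidal_orthogonality[of K "ds * dt / 2"]) auto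
  then have "(\<Sum>k=1..K. cos (\<theta> m k)) = (\<Sum>k=1..K. cos (\<theta> (m + 1) k))"
    unfolding a_def d_def disc_var_deriv_chain_rule sum_subtractf by simp
  then show ?thesis
    by (simp add: disc_hamiltonian_def flip: sum_distrib_right)
qed

lemma disc_hamiltonian_conserved:
  assumes "K \<ge> 0" and "ds > 0" and "dt > 0" and "m \<le> M + 1"
    and "disc_sine_gordon M ds dt \<theta>"
    and "\<forall>m\<le>M + 1. \<forall>k. \<theta> m (k + K) = \<theta> m k + 2 * of_int n * pi"
  shows "disc_hamiltonian K ds (\<theta> m) = disc_hamiltonian K ds (\<theta> 0)"
  using assms(4)
proof (induction m)
  case 0
  show ?case by simp
next
  case (Suc m)
  then show ?case
    using disc_hamiltonian_conserved_step[OF assms(1-3) _ assms(5,6), of m] by simp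
qed

theorem theorem3p4:
  fixes K n :: int and M :: nat and ds dt :: real
    and \<theta> x u :: "nat \<Rightarrow> int \<Rightarrow> real"
  assumes "K \<ge> 1" and "ds > 0" and "dt > 0"
    and "disc_sine_gordon M ds dt \<theta>"
    and "\<forall>m\<le>M + 1. \<forall>k. \<theta> m (k + K) = \<theta> m k + 2 * of_int n * pi"
    and "disc_hodograph M ds \<theta> x u"
  shows "\<forall>m\<le>M. \<forall>k.
           x m (k + K) = x m k + (- disc_hamiltonian K ds (\<theta> 0)) \<and>
           u m (k + K) = u m k"
proof (intro allI impI conjI)
  fix m k
  assume m: "m \<le> M"
  have K: "K \<ge> 0" using assms(1) by simp
  show "x m (k + K) = x m k + (- disc_hamiltonian K ds (\<theta> 0))"
  proof -
    have dx: "x m (j + 1) - x m j = cos (\<theta> m (j + 1)) * ds" for j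
    proof -
      have "(x m (j + 1) - x m j) / ds = cos (\<theta> m (j + 1))"
        using assms(6) m unfolding disc_hodograph_def by (metis add_diff_cancel_right')
      then show ?thesis using assms(2) by (simp add: field_simps)
    qed
    have "x m (j + 1 + K) - x m (j + 1) = x m (j + K) - x m j" for j
    proof -
      have "\<theta> m (j + 1 + K) = \<theta> m (j + 1) + 2 * of_int n * pi"
        using assms(5) m by simp
      then have "cos (\<theta> m (j + 1 + K)) = cos (\<theta> m (j + 1))"
        by (simp only: cos_sin_add_int_multiple_2pi)
      moreover have "j + K + 1 = j + 1 + K" by simp
      ultimately have "x m (j + 1 + K) - x m (j + K) = x m (j + 1) - x m j"
        using dx[of "j + K"] dx[of j] by metis
      then show ?thesis by linarith
    qed
    from constant_on_int_if_zero_difference[of "\<lambda>j. x m (j + K) - x m j", OF this]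
    have "x m (k + K) - x m k = x m K - x m 0" by simp
    also have "\<dots> = - disc_hamiltonian K ds (\<theta> m)"
      using disc_hodograph_sum_form(1)[OF assms(6,2) m K] by (simp add: disc_hamiltonian_def)
    also have "disc_hamiltonian K ds (\<theta> m) = disc_hamiltonian K ds (\<theta> 0)"
      using m by (intro disc_hamiltonian_conserved[OF K assms(2,3) _ assms(4,5)]) simp
    finally show ?thesis by simp
  qed
  show "u m (k + K) = u m k"
  proof -
    define d where "d j = \<theta> (m + 1) j - \<theta> m j" for j
    have "u m (j + 1) - d (j + 1) / dt = u m j - d j / dt" for j
    proof -
      have "(u m (j + 1) - u m j) / ds
          = (disc_var_deriv (\<theta> (m + 1)) (\<theta> m) (j + 1) + disc_var_deriv (\<theta> (m + 1)) (\<theta> m) j) / 2"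
        using assms(6) m unfolding disc_hodograph_def by (metis add_diff_cancel_right')
      also have "\<dots> = (d (j + 1) / dt - d j / dt) / ds"
        using assms(4) m by (simp add: disc_sine_gordon_def d_def)
      finally show ?thesis using assms(2) by simp
    qed
    from constant_on_int_if_zero_difference[of "\<lambda>j. u m j - d j / dt", OF this]
    have "u m (k + K) - d (k + K) / dt = u m k - d k / dt" by metis
    moreover have "d (k + K) = d k"
      using assms(5) m by (simp add: d_def)
    ultimately show ?thesis by simp
  qed
qed

end
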